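(* For $x>0$ let $T(x)=x\cdot x^{1/x}$ and $\mathsf{a}_s(x)=(T'(x)-1)x$. For integers $n\ge1$ let $s_n=(n+1)\sqrt[n+1]{n+1}-n\sqrt[n]{n}$. Then: (a) $\lim_{n\to\infty}s_n=1$; (b) $2>s_1>s_2>s_3>\cdots>1$; (c) $1+\frac{\mathsf{a}_s(n+1)}{n+1}<s_n<1+\frac{\mathsf{a}_s(n)}{n}$ for all $n\ge1$; (d) $\lim_{n\to\infty}\mathsf{a}_s(n)=1$. *)

theory Defs
  imports "HOL-Analysis.Analysis"
begin

text \<open>
  Only the values of \<open>T\<close> on the positive reals are meaningful; as this set is open, they
  determine \<open>deriv T x\<close> for every positive \<open>x\<close>.
\<close>

definition T :: "real \<Rightarrow> real" where
  "T x = x * x powr (1 / x)"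

definition a_s :: "real \<Rightarrow> real" where
  "a_s x = (deriv T x - 1) * x"

definition s :: "nat \<Rightarrow> real" where
  "s n = real (n + 1) * root (n + 1) (real (n + 1)) - real n * root n (real n)"

end

theory Submission
  imports Defs "HOL-Real_Asymp.Real_Asymp"
begin

text \<open>
  The second derivative of \<open>T\<close> has the sign of \<open>(1 - ln x)\<^sup>2 - x\<close>, which is negative for \<open>x > 1\<close>.
  Hence the derivative of \<open>T\<close> is strictly decreasing on \<open>[1, \<infinity>)\<close>, from the value 2 at 1 to the
  limit 1. Since \<open>s n = T (n + 1) - T n\<close> is a value of this derivative between \<open>n\<close> and \<open>n + 1\<close>,
  and \<open>1 + a_s x / x\<close> is its value at \<open>x\<close>, everything but the limit of \<open>a_s\<close> follows.
\<close>

text \<open>The derivative of \<open>T\<close> on the positive reals in closed form.\<close>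

definition T' :: "real \<Rightarrow> real" where
  "T' x = x powr (1 / x) * (1 + (1 - ln x) / x)"

lemma powr_inverse_has_derivative:
  fixes x :: real
  assumes "x > 0"
  shows "((\<lambda>x. x powr (1 / x)) has_real_derivative x powr (1 / x) * (1 - ln x) / x\<^sup>2) (at x)"
proof -
  have "((\<lambda>x. 1 / x) has_real_derivative - 1 / x\<^sup>2) (at x)"
    using assms by (auto intro!: derivative_eq_intros simp: power2_eq_square)
  from DERIV_powr[OF DERIV_ident assms this] show ?thesis
    by (rule DERIV_cong) (use assms in \<open>simp add: field_simps power2_eq_square\<close>)
qed

lemma T_has_derivative:
  assumes "x > 0"
  shows "(T has_real_derivative T' x) (at x)"
  unfolding T_def [abs_def] T'_def
  using assms
  by (auto intro!: derivative_eq_intros powr_inverse_has_derivative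
           simp: field_simps power2_eq_square)

lemma T'_has_derivative:
  assumes "x > 0"
  shows "(T' has_real_derivative x powr (1 / x) * ((1 - ln x)\<^sup>2 - x) / x ^ 3) (at x)"
  unfolding T'_def [abs_def]
  using assms
  by (auto intro!: derivative_eq_intros powr_inverse_has_derivative
           simp: field_simps power2_eq_square power3_eq_cube)

text \<open>It suffices that \<open>1 - ln x\<close> lies strictly between \<open>- sqrt x\<close>
  and \<open>sqrt x\<close>. The upper bound is immediate from \<open>ln x > 0\<close> and
  \<open>sqrt x > 1\<close>; the lower one needs an estimate of \<open>ln x\<close> by
  \<open>sqrt x\<close>.\<close>

lemma one_minus_ln_squared_less:
  fixes x :: real
  assumes "x > 1"
  shows "(1 - ln x)\<^sup>2 < x"
proof -
  have root: "sqrt x > 1" using assms by simp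
  \<comment> \<open>This is the tangent to \<open>ln\<close> at 2, taken at \<open>sqrt x\<close>.
    Doubled, it gives \<open>ln x\<close> at most \<open>sqrt x - 2 + 2 * ln 2\<close>, with
    coefficient exactly 1 at \<open>sqrt x\<close>.\<close>
  have "ln (sqrt x / 2) \<le> sqrt x / 2 - 1"
    using root by (intro ln_le_minus_one) simp
  moreover have "ln (sqrt x / 2) = ln x / 2 - ln 2"
    using assms by (simp add: ln_div ln_sqrt)
  moreover have "ln (2::real) < 1"
    using ln_2_less_1 .
  ultimately have "ln x - 1 < sqrt x" by simp
  moreover have "1 - ln x < sqrt x"
    using root ln_gt_zero[OF assms] by linarith
  ultimately have "\<bar>1 - ln x\<bar> < \<bar>sqrt x\<bar>" by linarith
  then have "(1 - ln x)\<^sup>2 < (sqrt x)\<^sup>2" by (metis abs_le_square_iff not_le)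
  then show ?thesis using assms by simp
qed

lemma T'_strict_antimono:
  assumes "1 \<le> x" "x < y"
  shows "T' y < T' x"
\<comment> \<open>The derivative of \<open>T'\<close> vanishes at 1, so for \<open>x = 1\<close> it
  is negative only in the interior; continuity covers the endpoints.\<close>
proof (rule DERIV_neg_imp_decreasing_open[OF assms(2)])
  fix z assume z: "x < z" "z < y"
  with assms have "z > 1" by simp
  then show "\<exists>d. (T' has_real_derivative d) (at z) \<and> d < 0"
    using T'_has_derivative[of z] one_minus_ln_squared_less[of z]
    by (intro exI conjI, assumption?) (auto simp: divide_less_0_iff mult_less_0_iff)
next
  show "continuous_on {x..y} T'"
    using assms
    by (intro continuous_at_imp_continuous_on ballI DERIV_isCont[OF T'_has_derivative]) auto
qed

lemma T'_tendsto: "(T' \<longlongrightarrow> 1) at_top"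
  unfolding T'_def [abs_def] by real_asymp

lemma T'_gt_1:
  assumes "1 \<le> x"
  shows "1 < T' x"
proof -
  \<comment> \<open>Passing to the limit yields only a weak inequality; applying it at
    \<open>x + 1\<close> leaves room for a strict one at \<open>x\<close>.\<close>
  have "eventually (\<lambda>y. T' y \<le> T' (x + 1)) at_top"
    using eventually_gt_at_top[of "x + 1"]
    by eventually_elim (use assms in \<open>auto intro!: less_imp_le T'_strict_antimono\<close>)
  then have "1 \<le> T' (x + 1)"
    by (intro tendsto_upperbound[OF T'_tendsto]) auto
  also have "\<dots> < T' x"
    using assms by (intro T'_strict_antimono) auto
  finally show ?thesis .
qed

lemma a_s_eq: "x > 0 \<Longrightarrow> a_s x = (T' x - 1) * x"
  unfolding a_s_def using DERIV_imp_deriv[OF T_has_derivative] by simp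

text \<open>Since \<open>x powr (1 / x)\<close> is \<open>1 + ln x / x\<close> up to
  \<open>O((ln x / x)^2)\<close>, the logarithmic terms of first order in \<open>T' x - 1\<close>
  cancel and \<open>1 / x\<close> remains.\<close>

lemma a_s_tendsto: "(\<lambda>n. a_s (real n)) \<longlonglongrightarrow> 1"
proof -
  have "((\<lambda>x. (T' x - 1) * x) \<longlongrightarrow> 1) at_top"
    unfolding T'_def by real_asymp
  then have "(\<lambda>n. (T' (real n) - 1) * real n) \<longlonglongrightarrow> 1"
    by (rule filterlim_compose) (rule filterlim_real_sequentially)
  moreover have "\<forall>\<^sub>F n in sequentially. (T' (real n) - 1) * real n = a_s (real n)"
    using eventually_gt_at_top[of 0] by eventually_elim (simp add: a_s_eq)
  ultimately show ?thesis by (rule Lim_transform_eventually)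
qed

lemma s_bounds:
  assumes "n \<ge> 1"
  shows "T' (real (n + 1)) < s n" and "s n < T' (real n)"
proof -
  have "\<exists>z>real n. z < real (n + 1) \<and>
      T (real (n + 1)) - T (real n) = (real (n + 1) - real n) * T' z"
    using assms by (intro MVT2 T_has_derivative) auto
  then obtain z where z: "real n < z" "z < real (n + 1)"
    and "T (real (n + 1)) - T (real n) = T' z"
    by auto
  moreover have "s n = T (real (n + 1)) - T (real n)"
    using assms by (simp add: s_def T_def root_powr_inverse)
  ultimately have "s n = T' z" by simp
  then show "T' (real (n + 1)) < s n" and "s n < T' (real n)"
    using z assms by (simp_all add: T'_strict_antimono)
qed

theorem theorem1:
  shows "s \<longlonglongrightarrow> 1
    \<and> (2 > s 1 \<and> (\<forall>n::nat. n \<ge> 1 \<longrightarrow> s n > s (n + 1)) \<and> (\<forall>n::nat. n \<ge> 1 \<longrightarrow> s n > 1))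
    \<and> (\<forall>n::nat. n \<ge> 1 \<longrightarrow>
          1 + a_s (real (n + 1)) / real (n + 1) < s n \<and> s n < 1 + a_s (real n) / real n)
    \<and> (\<lambda>n::nat. a_s (real n)) \<longlonglongrightarrow> 1"
proof (intro conjI allI impI)
  have gt_1: "s n > 1" if "n \<ge> 1" for n
    using s_bounds(1)[OF that] T'_gt_1[of "real (n + 1)"] by simp
  have T'_eq: "1 + a_s (real n) / real n = T' (real n)" if "n \<ge> 1" for n
    using that by (simp add: a_s_eq)
  show "s \<longlonglongrightarrow> 1"
  proof (rule tendsto_sandwich)
    show "\<forall>\<^sub>F n in sequentially. 1 \<le> s n"
      using eventually_ge_at_top[of 1] by eventually_elim (use gt_1 in \<open>auto intro: less_imp_le\<close>)
    show "\<forall>\<^sub>F n in sequentially. s n \<le> T' (real n)"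
      using eventually_ge_at_top[of 1]
      by eventually_elim (use s_bounds(2) in \<open>auto intro: less_imp_le\<close>)
    show "(\<lambda>n. T' (real n)) \<longlonglongrightarrow> 1"
      by (rule filterlim_compose[OF T'_tendsto filterlim_real_sequentially])
  qed simp
  show "2 > s 1"
    using s_bounds(2)[of 1] by (simp add: T'_def)
  show "(\<lambda>n. a_s (real n)) \<longlonglongrightarrow> 1"
    by (rule a_s_tendsto)
  fix n :: nat assume n: "n \<ge> 1"
  show "s n > 1"
    using gt_1[OF n] .
  \<comment> \<open>The value \<open>T' (real (n + 1))\<close> separates the two terms.\<close>
  show "s n > s (n + 1)"
    using s_bounds(2)[of "n + 1"] s_bounds(1)[OF n] by simp
  show "1 + a_s (real (n + 1)) / real (n + 1) < s n"
    using s_bounds(1)[OF n] T'_eq[of "n + 1"] by simp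
  show "s n < 1 + a_s (real n) / real n"
    using s_bounds(2)[OF n] T'_eq[OF n] by simp
qed

end
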